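(* Let $\mathcal{G}=(\mathcal{N},\mathcal{X}=\prod_{i=1}^N\mathbb{R}^{n_i},\{u_i\}_{i=1}^N)$ be a $\lambda$-cocoercive continuous game ($\lambda>0$) whose set of Nash equilibria $\mathcal{X}^*$ is nonempty. Let $(\mathbf{x}_t)_{t\ge0}$ be the noisy online gradient descent iterates $\mathbf{x}_{t+1}=\mathbf{x}_t+\eta_{t+1}(\mathbf{v}(\mathbf{x}_t)+\xi_{t+1})$ with absolute random noise, i.e. $\mathbb{E}[\xi_{t+1}\mid\mathcal{F}_t]=0$ and $\mathbb{E}[\|\xi_{t+1}\|^2\mid\mathcal{F}_t]\le\sigma_t^2$ for all $t\ge0$, where $\sigma_t^2\in(0,\sigma^2]$ for some $\sigma^2<+\infty$, and with step-sizes $\eta_t=c/\sqrt{t}$ ($t\ge1$) for some constant $c\in(0,\lambda)$. Then $$\frac{1}{T+1}\,\mathbb{E}\left[\sum_{t=0}^T\epsilon(\mathbf{x}_t)\right]=O\left(\frac{\log(T)}{\sqrt{T}}\right)\quad\text{as }T\to\infty.$$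
   Context: A continuous game $\mathcal{G}=(\mathcal{N},\mathcal{X}=\prod_{i=1}^N\mathcal{X}_i,\{u_i\}_{i=1}^N)$ consists of a finite set of players $\mathcal{N}=\{1,\dots,N\}$, action sets $\mathcal{X}_i$ (here $\mathcal{X}_i=\mathbb{R}^{n_i}$), and payoff functions $u_i:\mathcal{X}\to\mathbb{R}$ such that each $u_i$ is continuous in $\mathbf{x}$, continuously differentiable in $x_i$, and the partial gradient $\nabla_{x_i}u_i(\mathbf{x})$ is Lipschitz continuous in $\mathbf{x}$. Write $v_i(\mathbf{x})=\nabla_{x_i}u_i(\mathbf{x})$ and $\mathbf{v}(\mathbf{x})=(v_1(\mathbf{x}),\dots,v_N(\mathbf{x}))$. A point $\mathbf{x}^*\in\mathcal{X}$ is a Nash equilibrium if for every $i$, $u_i(x_i^*,\mathbf{x}_{-i}^* )\ge u_i(x_i,\mathbf{x}_{-i}^* )$ for all $x_i\in\mathcal{X}_i$, where $\mathbf{x}_{-i}$ denotes the joint action of all players except $i$. The game is $\lambda$-cocoercive if $(\mathbf{x}'-\mathbf{x})^\top(\mathbf{v}(\mathbf{x}')-\mathbf{v}(\mathbf{x}))\le-\lambda\|\mathbf{v}(\mathbf{x}')-\mathbf{v}(\mathbf{x})\|^2$ for all $\mathbf{x},\mathbf{x}'\in\mathcal{X}$. The norm $\|\cdot\|$ is Euclidean, and $\epsilon(\mathbf{x})=\|\mathbf{v}(\mathbf{x})\|^2$. The initial point $\mathbf{x}_0$ is arbitrary (deterministic). The noise $(\xi_t)_{t\ge1}$ is an $L^2$-bounded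 martingale difference sequence adapted to the history $(\mathcal{F}_t)$ of the iterates ($\mathbf{x}_t$ and $\xi_t$ are $\mathcal{F}_t$-measurable). The $\sigma_t$ are deterministic. *)

theory Defs
  imports "HOL-Probability.Probability" "HOL-Library.Landau_Symbols"
begin

text \<open>
  The players form a finite type \<open>'p\<close>. Player dimensions \<open>n\<^sub>i\<close> may differ, so the joint action
  space, the product of the \<open>\<real>\<close>-spaces of dimension \<open>n\<^sub>i\<close>, is \<open>real ^ 'm\<close>, where \<open>'m\<close> is the type of
  all coordinates and \<open>own k\<close> is the player to whom coordinate \<open>k\<close> belongs. Thus \<open>n\<^sub>i\<close> is the
  cardinality of \<open>{k. own k = i}\<close>, and every tuple of dimensions arises in this way.
\<close>

text \<open>The joint action \<open>(y\<^sub>i, x\<^sub>-\<^sub>i)\<close>; only the \<open>i\<close>-th block of \<open>y\<close> is used.\<close>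

definition deviate :: "('m::finite \<Rightarrow> 'p) \<Rightarrow> 'p \<Rightarrow> real ^ 'm \<Rightarrow> real ^ 'm \<Rightarrow> real ^ 'm" where
  "deviate own i y x = (\<chi> k. if own k = i then y $ k else x $ k)"

text \<open>
  The gradient in the \<open>i\<close>-th block, padded with zeros in the other blocks: the
  function below depends on \<open>y\<close> only through its \<open>i\<close>-th block.
\<close>

definition partial_gradient ::
    "('m::finite \<Rightarrow> 'p) \<Rightarrow> 'p \<Rightarrow> (real ^ 'm \<Rightarrow> real) \<Rightarrow> real ^ 'm \<Rightarrow> real ^ 'm" where
  "partial_gradient own i f x = (THE g. GDERIV (\<lambda>y. f (deviate own i y x)) x :> g)"

definition continuous_game ::
    "('m::finite \<Rightarrow> 'p::finite) \<Rightarrow> ('p \<Rightarrow> real ^ 'm \<Rightarrow> real) \<Rightarrow> bool" where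
  "continuous_game own u \<longleftrightarrow>
     (\<forall>i. continuous_on UNIV (u i) \<and>
          (\<forall>x. \<exists>g. GDERIV (\<lambda>y. u i (deviate own i y x)) x :> g) \<and>
          (\<forall>x. continuous_on UNIV (\<lambda>y. partial_gradient own i (u i) (deviate own i y x))) \<and>
          (\<exists>L. L-lipschitz_on UNIV (partial_gradient own i (u i))))"

text \<open>The stacked vector \<open>v(x) = (v\<^sub>1(x), \<dots>, v\<^sub>N(x))\<close>: the block of player \<open>i\<close> is that of \<open>v\<^sub>i(x)\<close>.\<close>

definition game_field ::
    "('m::finite \<Rightarrow> 'p) \<Rightarrow> ('p \<Rightarrow> real ^ 'm \<Rightarrow> real) \<Rightarrow> real ^ 'm \<Rightarrow> real ^ 'm" where
  "game_field own u x = (\<chi> k. partial_gradient own (own k) (u (own k)) x $ k)"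

definition nash_equilibria ::
    "('m::finite \<Rightarrow> 'p) \<Rightarrow> ('p \<Rightarrow> real ^ 'm \<Rightarrow> real) \<Rightarrow> (real ^ 'm) set" where
  "nash_equilibria own u = {x. \<forall>i y. u i x \<ge> u i (deviate own i y x)}"

definition cocoercive_game ::
    "real \<Rightarrow> ('m::finite \<Rightarrow> 'p::finite) \<Rightarrow> ('p \<Rightarrow> real ^ 'm \<Rightarrow> real) \<Rightarrow> bool" where
  "cocoercive_game lam own u \<longleftrightarrow> continuous_game own u \<and>
     (\<forall>x x'. (x' - x) \<bullet> (game_field own u x' - game_field own u x)
              \<le> - lam * (norm (game_field own u x' - game_field own u x))\<^sup>2)"

definition residual ::
    "('m::finite \<Rightarrow> 'p) \<Rightarrow> ('p \<Rightarrow> real ^ 'm \<Rightarrow> real) \<Rightarrow> real ^ 'm \<Rightarrow> real" where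
  "residual own u x = (norm (game_field own u x))\<^sup>2"

text \<open>
  The noise is indexed from 1 on; \<open>\<xi> 0\<close> is not used. The conditional expectation of the vector
  \<open>\<xi> (Suc t)\<close> is taken coordinatewise.
\<close>

definition L2_bounded_mds ::
    "'a measure \<Rightarrow> (nat \<Rightarrow> 'a measure) \<Rightarrow> (nat \<Rightarrow> 'a \<Rightarrow> real ^ 'm::finite) \<Rightarrow> bool" where
  "L2_bounded_mds M F \<xi> \<longleftrightarrow>
     (\<forall>t\<ge>1. \<xi> t \<in> borel_measurable (F t)) \<and>
     (\<exists>B. \<forall>t\<ge>1. integrable M (\<lambda>\<omega>. (norm (\<xi> t \<omega>))\<^sup>2) \<and> (\<integral>\<omega>. (norm (\<xi> t \<omega>))\<^sup>2 \<partial>M) \<le> B) \<and>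
     (\<forall>t k. AE \<omega> in M. real_cond_exp M (F t) (\<lambda>\<omega>. \<xi> (Suc t) \<omega> $ k) \<omega> = 0)"

lemma partial_gradient_eq:
  assumes "GDERIV (\<lambda>y. f (deviate own i y x)) x :> g"
  shows "partial_gradient own i f x = g"
  unfolding partial_gradient_def
proof (rule the_equality)
  show "GDERIV (\<lambda>y. f (deviate own i y x)) x :> g" by (fact assms)
next
  fix h assume "GDERIV (\<lambda>y. f (deviate own i y x)) x :> h"
  then have "(\<lambda>z. z \<bullet> h) = (\<lambda>z. z \<bullet> g)"
    using assms unfolding gderiv_def by (rule has_derivative_unique)
  then have "\<And>z. z \<bullet> h = z \<bullet> g" by meson
  then show "h = g" using vector_eq_ldot by blast
qed

end

theory Submission
  imports Defs "HOL-Real_Asymp.Real_Asymp"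
begin

text \<open>
  Let \<open>D\<^sub>t\<close> be the squared distance of \<open>x\<^sub>t\<close> to a Nash equilibrium \<open>x\<^sup>*\<close>. The game is unconstrained, so
  \<open>v(x\<^sup>*) = 0\<close>, and cocoercivity at \<open>x\<^sup>*\<close> gives
  \<open>E D\<^sub>t\<^sub>+\<^sub>1 \<le> E D\<^sub>t - (2\<lambda>\<eta> - \<eta>\<^sup>2) E \<epsilon>(x\<^sub>t) + \<eta>\<^sup>2 \<sigma>\<^sup>2\<close> with \<open>\<eta> = \<eta>\<^sub>t\<^sub>+\<^sub>1\<close>; the terms linear in the noise
  vanish in expectation. Since \<open>\<eta> \<le> c < \<lambda>\<close>, the coefficient of \<open>E \<epsilon>(x\<^sub>t)\<close> is at least \<open>\<lambda>\<eta>\<close>.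
  Telescoping bounds \<open>\<Sum>\<^sub>t \<eta>\<^sub>t\<^sub>+\<^sub>1 E \<epsilon>(x\<^sub>t)\<close> by a constant plus \<open>\<sigma>\<^sup>2 \<Sum>\<^sub>t \<eta>\<^sub>t\<^sub>+\<^sub>1\<^sup>2 = O(log T)\<close>, and
  every step size up to time \<open>T\<close> is at least \<open>c / \<surd>(T + 1)\<close>.
\<close>

section \<open>Zeros and Lipschitz continuity of the game field\<close>

text \<open>Fermat's rule for each player: the payoff as a function of the own block is maximal at
  \<open>xs\<close> over the whole space, so there is no boundary and the derivative
  vanishes.\<close>

lemma game_field_nash_eq_0:
  fixes own :: "'m::finite \<Rightarrow> 'p::finite"
  assumes game: "continuous_game own u" and nash: "xs \<in> nash_equilibria own u"
  shows "game_field own u xs = 0"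
proof -
  have "partial_gradient own i (u i) xs = 0" for i
  proof -
    obtain g where g: "GDERIV (\<lambda>y. u i (deviate own i y xs)) xs :> g"
      using game unfolding continuous_game_def by blast
    have self: "deviate own i xs xs = xs"
      by (simp add: deviate_def vec_eq_iff)
    have "(\<lambda>h. h \<bullet> g) = (\<lambda>h. 0)"
      by (rule differential_zero_maxmin[where S = UNIV and x = xs])
        (use g nash in \<open>auto simp: gderiv_def nash_equilibria_def self\<close>)
    then have "g = 0"
      by (metis inner_eq_zero_iff)
    then show ?thesis
      using partial_gradient_eq[OF g] by simp
  qed
  then show ?thesis
    by (simp add: game_field_def vec_eq_iff)
qed

text \<open>Cauchy-Schwarz bounds the inner product, and one factor \<open>norm (v x - v y)\<close>
  cancels. This provides the measurability and the square integrability of the field along the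
  iterates.\<close>

lemma cocoercive_imp_lipschitz:
  fixes v :: "'b::real_inner \<Rightarrow> 'b"
  assumes "lam > 0"
    and coco: "\<And>x y. (y - x) \<bullet> (v y - v x) \<le> - lam * (norm (v y - v x))\<^sup>2"
  shows "(1 / lam)-lipschitz_on UNIV v"
proof (rule lipschitz_onI)
  fix x y
  let ?d = "norm (v x - v y)"
  have "lam * ?d\<^sup>2 \<le> \<bar>(x - y) \<bullet> (v x - v y)\<bar>"
    using coco[of x y] by linarith
  also have "\<dots> \<le> norm (x - y) * ?d"
    by (rule Cauchy_Schwarz_ineq2)
  finally have "?d * (lam * ?d) \<le> ?d * norm (x - y)"
    by (simp add: power2_eq_square algebra_simps)
  then have "lam * ?d \<le> norm (x - y)"
    by (cases "?d = 0") (auto simp: mult_le_cancel_left)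
  then show "dist (v x) (v y) \<le> 1 / lam * dist x y"
    using \<open>lam > 0\<close> by (simp add: dist_norm field_simps)
qed (use \<open>lam > 0\<close> in simp)

section \<open>Square integrability and orthogonality of the noise\<close>

lemma integrable_norm_add_square:
  fixes f g :: "'a \<Rightarrow> 'b::euclidean_space"
  assumes [measurable]: "f \<in> borel_measurable M" "g \<in> borel_measurable M"
    and "integrable M (\<lambda>\<omega>. (norm (f \<omega>))\<^sup>2)" "integrable M (\<lambda>\<omega>. (norm (g \<omega>))\<^sup>2)"
  shows "integrable M (\<lambda>\<omega>. (norm (f \<omega> + g \<omega>))\<^sup>2)"
proof (rule Bochner_Integration.integrable_bound)
  show "integrable M (\<lambda>\<omega>. 2 * (norm (f \<omega>))\<^sup>2 + 2 * (norm (g \<omega>))\<^sup>2)"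
    using assms by simp
  have "(norm (a + b))\<^sup>2 \<le> 2 * (norm a)\<^sup>2 + 2 * (norm b)\<^sup>2" for a b :: 'b
    \<comment> \<open>By the parallelogram law the right side exceeds the left by exactly the square
      of \<open>norm (a - b)\<close>.\<close>
    using zero_le_power2[of "norm (a - b)"]
    unfolding power2_norm_eq_inner by (simp add: inner_simps inner_commute)
  then show "AE \<omega> in M. norm ((norm (f \<omega> + g \<omega>))\<^sup>2) \<le> norm (2 * (norm (f \<omega>))\<^sup>2 + 2 * (norm (g \<omega>))\<^sup>2)"
    by (auto intro!: always_eventually)
qed simp

lemma integrable_mult_square_integrable:
  fixes f g :: "'a \<Rightarrow> real"
  assumes [measurable]: "f \<in> borel_measurable M" "g \<in> borel_measurable M"
    and "integrable M (\<lambda>\<omega>. (f \<omega>)\<^sup>2)" "integrable M (\<lambda>\<omega>. (g \<omega>)\<^sup>2)"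
  shows "integrable M (\<lambda>\<omega>. f \<omega> * g \<omega>)"
proof (rule Bochner_Integration.integrable_bound)
  show "integrable M (\<lambda>\<omega>. (f \<omega>)\<^sup>2 + (g \<omega>)\<^sup>2)"
    using assms by simp
  have "\<bar>a * b\<bar> \<le> a\<^sup>2 + b\<^sup>2" for a b :: real
    using sum_squares_bound[of "\<bar>a\<bar>" "\<bar>b\<bar>"] abs_ge_zero[of "a * b"]
    unfolding abs_mult power2_abs mult.assoc by linarith
  then show "AE \<omega> in M. norm (f \<omega> * g \<omega>) \<le> norm ((f \<omega>)\<^sup>2 + (g \<omega>)\<^sup>2)"
    by (auto intro!: always_eventually)
qed simp

lemma borel_measurable_component [measurable (raw)]:
  fixes f :: "'a \<Rightarrow> real ^ 'm::finite"
  assumes "f \<in> borel_measurable M"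
  shows "(\<lambda>\<omega>. f \<omega> $ k) \<in> borel_measurable M"
  using assms by (rule measurable_compose[OF _ borel_measurable_nth])

lemma integrable_component_square:
  fixes f :: "'a \<Rightarrow> real ^ 'm::finite"
  assumes [measurable]: "f \<in> borel_measurable M"
    and "integrable M (\<lambda>\<omega>. (norm (f \<omega>))\<^sup>2)"
  shows "integrable M (\<lambda>\<omega>. (f \<omega> $ k)\<^sup>2)"
  by (rule Bochner_Integration.integrable_bound[OF assms(2)])
    (auto simp: component_le_norm_cart abs_le_square_iff[symmetric] intro!: always_eventually)

text \<open>An \<open>F\<close>-measurable factor may be moved inside the conditional expectation,
  which then vanishes. The argument runs coordinatewise because \<open>real_cond_exp\<close> is
  real-valued; square integrability of both factors makes each product integrable.\<close>

lemma (in sigma_finite_subalgebra) inner_martingale_difference: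
  fixes f g :: "'a \<Rightarrow> real ^ 'm::finite"
  assumes f: "f \<in> borel_measurable F" "integrable M (\<lambda>\<omega>. (norm (f \<omega>))\<^sup>2)"
    and g[measurable]: "g \<in> borel_measurable M" and g2: "integrable M (\<lambda>\<omega>. (norm (g \<omega>))\<^sup>2)"
    and mean: "\<And>k. AE \<omega> in M. real_cond_exp M F (\<lambda>\<omega>. g \<omega> $ k) \<omega> = 0"
  shows "integrable M (\<lambda>\<omega>. f \<omega> \<bullet> g \<omega>)" "(\<integral>\<omega>. f \<omega> \<bullet> g \<omega> \<partial>M) = 0"
proof -
  have [measurable]: "f \<in> borel_measurable M"
    using f(1) by (rule measurable_from_subalg[OF subalg])
  have int: "integrable M (\<lambda>\<omega>. f \<omega> $ k * g \<omega> $ k)" for k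
    by (intro integrable_mult_square_integrable integrable_component_square f g2) measurable
  have "(\<integral>\<omega>. f \<omega> $ k * g \<omega> $ k \<partial>M) = 0" for k
  proof -
    have "(\<integral>\<omega>. f \<omega> $ k * g \<omega> $ k \<partial>M)
        = (\<integral>\<omega>. f \<omega> $ k * real_cond_exp M F (\<lambda>\<omega>. g \<omega> $ k) \<omega> \<partial>M)"
      by (rule real_cond_exp_intg(2)[OF int, symmetric])
        (use f(1) in measurable)
    also have "\<dots> = 0"
      by (rule integral_eq_zero_AE) (use mean[of k] in auto)
    finally show ?thesis .
  qed
  then show "(\<integral>\<omega>. f \<omega> \<bullet> g \<omega> \<partial>M) = 0"
    using int by (simp add: inner_vec_def)
  show "integrable M (\<lambda>\<omega>. f \<omega> \<bullet> g \<omega>)"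
    using int by (simp add: inner_vec_def)
qed

section \<open>Deterministic estimates\<close>

lemma harm_le_1_plus_ln:
  assumes "n > 0"
  shows "harm n \<le> 1 + ln (real n)"
  \<comment> \<open>The decreasing sequence is \<open>harm (Suc k) - ln (Suc k)\<close>, hence the
    index \<open>n - 1\<close>; its value at 0 is 1.\<close>
  using decseqD[OF decseq_harm_diff_ln, of 0 "n - 1"] assms by (simp add: harm_expand)

text \<open>Cocoercivity against the zero \<open>xs\<close> yields \<open>- 2 * lam * s\<close>
  times the squared field; \<open>s \<le> lam\<close> lets half of it absorb the quadratic term. The
  noise \<open>e\<close> is paired with the whole noiseless step
  \<open>a + s *\<^sub>R v a - xs\<close>, so that a single cross term remains to be averaged
  out.\<close>

lemma cocoercive_gradient_step:
  fixes v :: "'b::real_inner \<Rightarrow> 'b"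
  assumes coco: "\<And>x y. (y - x) \<bullet> (v y - v x) \<le> - lam * (norm (v y - v x))\<^sup>2"
    and "v xs = 0" and "0 \<le> s" "s \<le> lam"
  shows "(norm (a + s *\<^sub>R (v a + e) - xs))\<^sup>2 + lam * s * (norm (v a))\<^sup>2
    \<le> (norm (a - xs))\<^sup>2 + 2 * s * ((a + s *\<^sub>R v a - xs) \<bullet> e) + s\<^sup>2 * (norm e)\<^sup>2"
proof -
  have "(norm (a + s *\<^sub>R (v a + e) - xs))\<^sup>2 = (norm (a - xs))\<^sup>2 + 2 * s * ((a - xs) \<bullet> v a)
      + s * s * (norm (v a))\<^sup>2 + 2 * s * ((a + s *\<^sub>R v a - xs) \<bullet> e) + s\<^sup>2 * (norm e)\<^sup>2"
    unfolding power2_norm_eq_inner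
    by (simp add: inner_simps inner_commute power2_eq_square algebra_simps)
  moreover have "2 * s * ((a - xs) \<bullet> v a) \<le> 2 * s * (- lam * (norm (v a))\<^sup>2)"
    using coco[of a xs] assms by (intro mult_left_mono) auto
  moreover have "s * s * (norm (v a))\<^sup>2 \<le> lam * s * (norm (v a))\<^sup>2"
    using assms by (intro mult_right_mono) auto
  ultimately show ?thesis
    by (simp add: algebra_simps)
qed

text \<open>The smallest weight up to \<open>T\<close> is \<open>1 / sqrt (T + 1)\<close>, so
  replacing every weight by it costs one such factor; dividing by another one turns the sum into the
  average. The harmonic number contributes the logarithm.\<close>

lemma inverse_sqrt_average_bigo:
  fixes E :: "nat \<Rightarrow> real"
  assumes nonneg: "\<And>t. 0 \<le> E t"
    and bound: "\<And>T. (\<Sum>t\<le>T. E t / sqrt (real (Suc t))) \<le> A + B * harm (Suc T)"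
    and "0 \<le> A" "0 \<le> B"
  shows "(\<lambda>T. 1 / (real T + 1) * (\<Sum>t\<le>T. E t)) \<in> O(\<lambda>T. ln (real T) / sqrt (real T))"
proof -
  have le: "1 / (real T + 1) * (\<Sum>t\<le>T. E t) \<le> (A + B) * ((1 + ln (real T + 1)) / sqrt (real T + 1))"
    for T
  proof -
    let ?r = "sqrt (real T + 1)"
    have "(\<Sum>t\<le>T. E t) / ?r = (\<Sum>t\<le>T. E t / ?r)"
      by (rule sum_divide_distrib)
    also have "\<dots> \<le> (\<Sum>t\<le>T. E t / sqrt (real (Suc t)))"
      using nonneg by (intro sum_mono divide_left_mono) auto
    also have "\<dots> \<le> A + B * (1 + ln (real (Suc T)))"
      using bound[of T] harm_le_1_plus_ln[of "Suc T"] \<open>0 \<le> B\<close>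
      by (meson add_left_mono mult_left_mono order_trans zero_less_Suc)
    also have "\<dots> \<le> (A + B) * (1 + ln (real T + 1))"
      using \<open>0 \<le> A\<close> by (simp add: algebra_simps)
    finally have "(\<Sum>t\<le>T. E t) / ?r / ?r \<le> (A + B) * (1 + ln (real T + 1)) / ?r"
      by (rule divide_right_mono) simp
    then show ?thesis
      by simp
  qed
  have "(\<lambda>T. 1 / (real T + 1) * (\<Sum>t\<le>T. E t))
      \<in> O(\<lambda>T. (A + B) * ((1 + ln (real T + 1)) / sqrt (real T + 1)))"
    using le nonneg by (intro landau_o.big_mono always_eventually allI)
      (smt (verit) real_norm_def divide_nonneg_nonneg mult_nonneg_nonneg of_nat_0_le_iff sum_nonneg)
  also have "(\<lambda>T. (A + B) * ((1 + ln (real T + 1)) / sqrt (real T + 1)))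
      \<in> O(\<lambda>T. (1 + ln (real T + 1)) / sqrt (real T + 1))"
    by (intro bigoI[of _ "\<bar>A + B\<bar>"] always_eventually allI) (simp only: abs_mult real_norm_def order_refl)
  \<comment> \<open>Only large \<open>T\<close> count, so the zeros of the right side at 0 and 1 do
    no harm.\<close>
  also have "(\<lambda>T::nat. (1 + ln (real T + 1)) / sqrt (real T + 1)) \<in> O(\<lambda>T. ln (real T) / sqrt (real T))"
    by real_asymp
  finally show ?thesis .
qed

section \<open>Moments of the iterates, descent in expectation, and the rate\<close>

theorem theoremA3:
  fixes own :: "'m::finite \<Rightarrow> 'p::finite"
    and u :: "'p \<Rightarrow> real ^ 'm \<Rightarrow> real"
    and M :: "'a measure"
    and F :: "nat \<Rightarrow> 'a measure"
    and x \<xi> :: "nat \<Rightarrow> 'a \<Rightarrow> real ^ 'm"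
    and x0 :: "real ^ 'm"
    and \<eta> \<sigma> :: "nat \<Rightarrow> real"
    and lam c \<sigma>max :: real
  assumes "lam > 0"
    and "cocoercive_game lam own u"
    and "nash_equilibria own u \<noteq> {}"
    and "prob_space M"
    and "filtration (space M) F"
    and "\<And>t. subalgebra M (F t)"
    and "\<And>t. x t \<in> borel_measurable (F t)"
    and "\<And>\<omega>. \<omega> \<in> space M \<Longrightarrow> x 0 \<omega> = x0"
    and "\<And>t \<omega>. \<omega> \<in> space M \<Longrightarrow>
           x (Suc t) \<omega> = x t \<omega> + \<eta> (Suc t) *\<^sub>R (game_field own u (x t \<omega>) + \<xi> (Suc t) \<omega>)"
    and "L2_bounded_mds M F \<xi>"
    and "\<And>t. AE \<omega> in M. real_cond_exp M (F t) (\<lambda>\<omega>. (norm (\<xi> (Suc t) \<omega>))\<^sup>2) \<omega> \<le> (\<sigma> t)\<^sup>2"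
    and "\<And>t. (\<sigma> t)\<^sup>2 \<in> {0<..\<sigma>max\<^sup>2}"
    and "c \<in> {0<..<lam}"
    and "\<And>t. t \<ge> 1 \<Longrightarrow> \<eta> t = c / sqrt (real t)"
  shows "(\<forall>T. integrable M (\<lambda>\<omega>. \<Sum>t=0..T. residual own u (x t \<omega>))) \<and>
         (\<lambda>T. 1 / (real T + 1) * (\<integral>\<omega>. (\<Sum>t=0..T. residual own u (x t \<omega>)) \<partial>M))
           \<in> O(\<lambda>T. ln (real T) / sqrt (real T))"
proof -
  interpret prob_space M by fact
  let ?v = "game_field own u"
  have sub: "sigma_finite_subalgebra M (F t)" for t
    by (intro finite_measure_subalgebra_is_sigma_finite finite_measure_subalgebra.intro
        finite_measure_subalgebra_axioms.intro finite_measure_axioms assms)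
  have coco: "(y - x) \<bullet> (?v y - ?v x) \<le> - lam * (norm (?v y - ?v x))\<^sup>2" for x y
    using assms(2) unfolding cocoercive_game_def by blast
  obtain xs where xs: "?v xs = 0"
    using game_field_nash_eq_0 assms(2,3) unfolding cocoercive_game_def by blast
  have lip: "(1 / lam)-lipschitz_on UNIV ?v"
    using \<open>lam > 0\<close> coco by (rule cocoercive_imp_lipschitz)
  have v_meas[measurable]: "?v \<in> borel_measurable borel"
    using lip by (intro borel_measurable_continuous_onI lipschitz_on_continuous_on)
  have x_meas[measurable]: "x t \<in> borel_measurable M" for t
    using assms(6,7) by (rule measurable_from_subalg)
  have \<xi>_meas[measurable]: "\<xi> (Suc t) \<in> borel_measurable M" for t
    by (rule measurable_from_subalg[OF assms(6)[of "Suc t"]])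
      (use assms(10) in \<open>simp add: L2_bounded_mds_def\<close>)
  have \<xi>_int: "integrable M (\<lambda>\<omega>. (norm (\<xi> (Suc t) \<omega>))\<^sup>2)" for t
    using assms(10) unfolding L2_bounded_mds_def One_nat_def by (meson Suc_le_mono le0)
  have \<xi>_var: "(\<integral>\<omega>. (norm (\<xi> (Suc t) \<omega>))\<^sup>2 \<partial>M) \<le> \<sigma>max\<^sup>2" for t
  proof -
    interpret sigma_finite_subalgebra M "F t" by (rule sub)
    have "(\<integral>\<omega>. (norm (\<xi> (Suc t) \<omega>))\<^sup>2 \<partial>M)
        = (\<integral>\<omega>. real_cond_exp M (F t) (\<lambda>\<omega>. (norm (\<xi> (Suc t) \<omega>))\<^sup>2) \<omega> \<partial>M)"
      using real_cond_exp_int(2)[OF \<xi>_int] by simp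
    also have "\<dots> \<le> (\<integral>\<omega>. (\<sigma> t)\<^sup>2 \<partial>M)"
      using assms(11) by (intro integral_mono_AE real_cond_exp_int(1) \<xi>_int) auto
    also have "\<dots> \<le> \<sigma>max\<^sup>2"
      using assms(12)[of t] by (simp add: prob_space)
    finally show ?thesis .
  qed
  \<comment> \<open>Conditional on the distance at time \<open>t\<close>, because the induction for
    \<open>dist_int\<close> needs it with only the induction hypothesis at hand.\<close>
  have v_int_if: "integrable M (\<lambda>\<omega>. (norm (?v (x t \<omega>)))\<^sup>2)"
    if "integrable M (\<lambda>\<omega>. (norm (x t \<omega> - xs))\<^sup>2)" for t
  proof (rule Bochner_Integration.integrable_bound)
    show "integrable M (\<lambda>\<omega>. (1 / lam)\<^sup>2 * (norm (x t \<omega> - xs))\<^sup>2)"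
      using that by simp
    have "(norm (?v a))\<^sup>2 \<le> (1 / lam)\<^sup>2 * (norm (a - xs))\<^sup>2" for a
      using lipschitz_onD[OF lip, of a xs] xs
      by (simp add: dist_norm power_mono flip: power_mult_distrib)
    then show "AE \<omega> in M. norm ((norm (?v (x t \<omega>)))\<^sup>2) \<le> norm ((1 / lam)\<^sup>2 * (norm (x t \<omega> - xs))\<^sup>2)"
      by (auto intro!: always_eventually)
  qed measurable
  have scale: "integrable M (\<lambda>\<omega>. (norm (r *\<^sub>R f \<omega>))\<^sup>2)"
    if "integrable M (\<lambda>\<omega>. (norm (f \<omega>))\<^sup>2)" for r and f :: "'a \<Rightarrow> real ^ 'm"
    using that by (simp add: power_mult_distrib)
  have dist_int: "integrable M (\<lambda>\<omega>. (norm (x t \<omega> - xs))\<^sup>2)" for t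
  proof (induction t)
    case 0
    then show ?case
      using assms(8) by (subst Bochner_Integration.integrable_cong[OF refl, where g = "\<lambda>_. (norm (x0 - xs))\<^sup>2"]) auto
  next
    case (Suc t)
    have "integrable M (\<lambda>\<omega>. (norm ((x t \<omega> - xs) + \<eta> (Suc t) *\<^sub>R (?v (x t \<omega>) + \<xi> (Suc t) \<omega>)))\<^sup>2)"
      by (intro integrable_norm_add_square scale Suc v_int_if \<xi>_int) measurable
    then show ?case
      using assms(9)
      by (subst Bochner_Integration.integrable_cong[OF refl,
            where g = "\<lambda>\<omega>. (norm ((x t \<omega> - xs) + \<eta> (Suc t) *\<^sub>R (?v (x t \<omega>) + \<xi> (Suc t) \<omega>)))\<^sup>2"])
        (auto simp: algebra_simps)
  qed
  have v_int: "integrable M (\<lambda>\<omega>. (norm (?v (x t \<omega>)))\<^sup>2)" for t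
    using dist_int by (rule v_int_if)
  define E where "E t = (\<integral>\<omega>. (norm (?v (x t \<omega>)))\<^sup>2 \<partial>M)" for t
  define D where "D t = (\<integral>\<omega>. (norm (x t \<omega> - xs))\<^sup>2 \<partial>M)" for t
  have \<eta>: "\<eta> (Suc t) = c / sqrt (real (Suc t))" "0 \<le> \<eta> (Suc t)" "\<eta> (Suc t) \<le> lam" for t
  proof -
    show eq: "\<eta> (Suc t) = c / sqrt (real (Suc t))"
      by (rule assms(14)) simp
    show "0 \<le> \<eta> (Suc t)"
      using assms(13) by (simp add: eq)
    have "c / sqrt (real (Suc t)) \<le> c / 1"
      using assms(13) by (intro divide_left_mono) auto
    then show "\<eta> (Suc t) \<le> lam"
      using assms(13) by (simp add: eq)
  qed
  have descent: "D (Suc t) + lam * \<eta> (Suc t) * E t \<le> D t + (\<eta> (Suc t))\<^sup>2 * \<sigma>max\<^sup>2" for t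
  proof -
    interpret sigma_finite_subalgebra M "F t" by (rule sub)
    define s where "s = \<eta> (Suc t)"
    \<comment> \<open>The noiseless step is determined at time \<open>t\<close>, hence orthogonal in
      expectation to \<open>\<xi> (Suc t)\<close>.\<close>
    define f where "f \<omega> = x t \<omega> + s *\<^sub>R ?v (x t \<omega>) - xs" for \<omega>
    have F_meas: "f \<in> borel_measurable (F t)"
      unfolding f_def using assms(7)[of t] by measurable
    have "integrable M (\<lambda>\<omega>. (norm ((x t \<omega> - xs) + s *\<^sub>R ?v (x t \<omega>)))\<^sup>2)"
      by (intro integrable_norm_add_square scale dist_int v_int) measurable
    then have f_int: "integrable M (\<lambda>\<omega>. (norm (f \<omega>))\<^sup>2)"
      by (simp add: f_def algebra_simps)
    have mean: "AE \<omega> in M. real_cond_exp M (F t) (\<lambda>\<omega>. \<xi> (Suc t) \<omega> $ k) \<omega> = 0" for k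
      using assms(10) unfolding L2_bounded_mds_def by blast
    note cross = inner_martingale_difference[OF F_meas f_int \<xi>_meas \<xi>_int mean]
    have "D (Suc t) + lam * s * E t
        = (\<integral>\<omega>. (norm (x (Suc t) \<omega> - xs))\<^sup>2 + lam * s * (norm (?v (x t \<omega>)))\<^sup>2 \<partial>M)"
      unfolding D_def E_def using dist_int v_int by simp
    also have "\<dots> \<le> (\<integral>\<omega>. (norm (x t \<omega> - xs))\<^sup>2 + 2 * s * (f \<omega> \<bullet> \<xi> (Suc t) \<omega>)
        + s\<^sup>2 * (norm (\<xi> (Suc t) \<omega>))\<^sup>2 \<partial>M)"
    proof (rule integral_mono)
      fix \<omega> assume "\<omega> \<in> space M"
      then show "(norm (x (Suc t) \<omega> - xs))\<^sup>2 + lam * s * (norm (?v (x t \<omega>)))\<^sup>2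
          \<le> (norm (x t \<omega> - xs))\<^sup>2 + 2 * s * (f \<omega> \<bullet> \<xi> (Suc t) \<omega>) + s\<^sup>2 * (norm (\<xi> (Suc t) \<omega>))\<^sup>2"
        using cocoercive_gradient_step[where v = ?v, OF coco xs \<eta>(2,3)[of t]]
        by (simp add: assms(9) f_def s_def)
    qed (use dist_int v_int \<xi>_int cross in auto)
    also have "\<dots> = D t + s\<^sup>2 * (\<integral>\<omega>. (norm (\<xi> (Suc t) \<omega>))\<^sup>2 \<partial>M)"
      unfolding D_def using dist_int \<xi>_int cross by simp
    also have "\<dots> \<le> D t + s\<^sup>2 * \<sigma>max\<^sup>2"
      using \<xi>_var by (intro add_left_mono mult_left_mono) auto
    finally show ?thesis
      by (simp add: s_def)
  qed
  have D_nonneg: "0 \<le> D t" and E_nonneg: "0 \<le> E t" for t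
    by (simp_all add: D_def E_def)
  have telescoped: "D (Suc T) + lam * (\<Sum>t\<le>T. \<eta> (Suc t) * E t) \<le> D 0 + \<sigma>max\<^sup>2 * (\<Sum>t\<le>T. (\<eta> (Suc t))\<^sup>2)"
    for T
  proof (induction T)
    case 0
    then show ?case
      using descent[of 0] by (simp add: algebra_simps)
  next
    case (Suc T)
    then show ?case
      using descent[of "Suc T"] by (simp add: algebra_simps)
  qed
  have \<eta>_squares: "(\<Sum>t\<le>T. (\<eta> (Suc t))\<^sup>2) = c\<^sup>2 * harm (Suc T)" for T
  proof -
    \<comment> \<open>Harmonic sums start at 1, the iteration at 0.\<close>
    have "(harm (Suc T) :: real) = (\<Sum>t\<le>T. inverse (real (Suc t)))"
      unfolding harm_def by (rule sum.reindex_bij_witness[of _ Suc "\<lambda>k. k - 1"]) auto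
    then show ?thesis
      by (simp add: \<eta>(1) power_divide sum_distrib_left divide_inverse power_mult_distrib power_inverse)
  qed
  have lamc: "0 < lam * c"
    using assms(1,13) by simp
  have "(\<Sum>t\<le>T. E t / sqrt (real (Suc t))) \<le> D 0 / (lam * c) + \<sigma>max\<^sup>2 * c\<^sup>2 / (lam * c) * harm (Suc T)"
    for T
  proof -
    have "(lam * c) * (\<Sum>t\<le>T. E t / sqrt (real (Suc t))) = lam * (\<Sum>t\<le>T. \<eta> (Suc t) * E t)"
      by (simp add: \<eta>(1) sum_distrib_left mult.assoc)
    also have "\<dots> \<le> D 0 + \<sigma>max\<^sup>2 * c\<^sup>2 * harm (Suc T)"
      \<comment> \<open>The final distance \<open>D (Suc T)\<close> is nonnegative and is
        dropped.\<close>
      using telescoped[of T] D_nonneg[of "Suc T"] by (simp add: \<eta>_squares mult.assoc)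
    finally have "(\<Sum>t\<le>T. E t / sqrt (real (Suc t))) \<le> (D 0 + \<sigma>max\<^sup>2 * c\<^sup>2 * harm (Suc T)) / (lam * c)"
      using lamc by (simp only: pos_le_divide_eq mult.commute)
    then show ?thesis
      by (simp add: add_divide_distrib)
  qed
  then have "(\<lambda>T. 1 / (real T + 1) * (\<Sum>t\<le>T. E t)) \<in> O(\<lambda>T. ln (real T) / sqrt (real T))"
    by (rule inverse_sqrt_average_bigo[OF E_nonneg]) (use D_nonneg lamc in auto)
  moreover have "(\<integral>\<omega>. (\<Sum>t=0..T. residual own u (x t \<omega>)) \<partial>M) = (\<Sum>t\<le>T. E t)" for T
    using v_int by (simp add: residual_def E_def atMost_atLeast0)
  \<comment> \<open>The Bochner integral of a non-integrable function is 0 by default; integrability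
    ensures that the rate concerns a genuine expectation.\<close>
  moreover have "integrable M (\<lambda>\<omega>. \<Sum>t=0..T. residual own u (x t \<omega>))" for T
    using v_int by (simp add: residual_def)
  ultimately show ?thesis
    by simp
qed

end
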